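(* Let $L$ be a linear space over a field $\Bbbk$, $[\cdot ,\cdot ]:L\times L\rightarrow L$ a bilinear map, and $\alpha , \beta :L\rightarrow L$ two commuting linear maps such that $\alpha ([x, y])=[\alpha (x), \alpha (y)]$ and $\beta ([x, y])=[\beta (x), \beta (y)]$ for all $x, y\in L$, and such that the BiHom-skew-symmetry condition $[\beta (x), \alpha (y)]=-[\beta (y), \alpha (x)]$ holds for all $x,y\in L$. Assume that $\alpha $ and $\beta $ are bijective. Then the following three conditions are equivalent: (i) $(L, [\cdot ,\cdot ], \alpha , \beta )$ is a BiHom-Lie algebra; (ii) $(L, [\cdot ,\cdot ], \alpha , \beta )$ is a left BiHom-Lie algebra; (iii) $(L, [\cdot ,\cdot ], \alpha , \beta )$ is a right BiHom-Lie algebra.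
   Context: All linear spaces and (bi)linear maps are over a base field $\Bbbk$. A BiHom-Lie algebra $(L,[\cdot,\cdot],\alpha,\beta)$ is a linear space $L$ with linear maps $\alpha,\beta:L\to L$ and a bilinear map $[\cdot,\cdot]:L\times L\to L$ such that, for all $x,y,z\in L$: $\alpha\circ\beta=\beta\circ\alpha$; $\alpha([x,y])=[\alpha(x),\alpha(y)]$ and $\beta([x,y])=[\beta(x),\beta(y)]$; $[\beta(x),\alpha(y)]=-[\beta(y),\alpha(x)]$ (BiHom-skew-symmetry); and $$[\beta^2(x),[\beta(y),\alpha(z)]]+[\beta^2(y),[\beta(z),\alpha(x)]]+[\beta^2(z),[\beta(x),\alpha(y)]]=0$$ (BiHom-Jacobi condition). A left (respectively right) BiHom-Leibniz algebra is a 4-tuple $(L, [\cdot ,\cdot ], \alpha , \beta )$, where $L$ is a linear space, $[\cdot , \cdot ]:L\times L\rightarrow L$ is a bilinear map and $\alpha , \beta :L\rightarrow L$ are linear maps satisfying $\alpha \circ \beta =\beta \circ \alpha $, $\alpha ([x, y])=[\alpha (x), \alpha (y)]$, $\beta ([x, y])=[\beta (x), \beta (y)]$ and $$[\alpha \beta (x), [y, z]]=[[\beta (x), y], \beta (z)]+[\beta (y), [\alpha (x), z]],$$ respectively $$[[x, y], \alpha \beta (z)]=[[x, \beta (z)], \alpha (y)]+[\alpha (x), [y, \alpha (z)]],$$ for all $x, y, z\in L$ (here $\alpha\beta=\alpha\circ\beta$). A left (respectively right) BiHom-Lie algebra is a left (respectively right) BiHom-Leibniz algebra satisfying the BiHom-skew-symmetry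 condition. *)

theory Defs
  imports Complex_Main
begin

text \<open>A linear space over a field is rendered by a type \<open>'v\<close> together with an explicit scalar
  multiplication satisfying the library locale \<^locale>\<open>vector_space\<close>, for an arbitrary field
  \<open>'k\<close>.  Since Complex_Main redeclares \<open>linear\<close> for real vector spaces, the general notion is
  referred to by its qualified name.\<close>

definition bilinear_map ::
  "('k::field \<Rightarrow> 'v::ab_group_add \<Rightarrow> 'v) \<Rightarrow> ('v \<Rightarrow> 'v \<Rightarrow> 'v) \<Rightarrow> bool" where
  "bilinear_map scale br \<longleftrightarrow>
     (\<forall>x. Vector_Spaces.linear scale scale (\<lambda>y. br x y)) \<and>
     (\<forall>y. Vector_Spaces.linear scale scale (\<lambda>x. br x y))"

text \<open>The bracket of \<open>x\<close> and \<open>y\<close> is written \<open>br x y\<close>.\<close>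

definition bihom_skew_symmetric ::
  "('v::ab_group_add \<Rightarrow> 'v \<Rightarrow> 'v) \<Rightarrow> ('v \<Rightarrow> 'v) \<Rightarrow> ('v \<Rightarrow> 'v) \<Rightarrow> bool" where
  "bihom_skew_symmetric br \<alpha> \<beta> \<longleftrightarrow> (\<forall>x y. br (\<beta> x) (\<alpha> y) = - br (\<beta> y) (\<alpha> x))"

locale bihom_structure = vector_space scale
  for scale :: "'k::field \<Rightarrow> 'v::ab_group_add \<Rightarrow> 'v" +
  fixes br :: "'v \<Rightarrow> 'v \<Rightarrow> 'v" and \<alpha> :: "'v \<Rightarrow> 'v" and \<beta> :: "'v \<Rightarrow> 'v"
  assumes bilinear_br: "bilinear_map scale br"
    and linear_alpha: "Vector_Spaces.linear scale scale \<alpha>"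
    and linear_beta: "Vector_Spaces.linear scale scale \<beta>"
    and commute: "\<alpha> \<circ> \<beta> = \<beta> \<circ> \<alpha>"
    and alpha_br: "\<alpha> (br x y) = br (\<alpha> x) (\<alpha> y)"
    and beta_br: "\<beta> (br x y) = br (\<beta> x) (\<beta> y)"

locale bihom_lie_algebra = bihom_structure +
  assumes skew_symmetric: "bihom_skew_symmetric br \<alpha> \<beta>"
    and bihom_jacobi:
      "br (\<beta> (\<beta> x)) (br (\<beta> y) (\<alpha> z)) + br (\<beta> (\<beta> y)) (br (\<beta> z) (\<alpha> x))
         + br (\<beta> (\<beta> z)) (br (\<beta> x) (\<alpha> y)) = 0"

locale left_bihom_leibniz_algebra = bihom_structure +
  assumes left_leibniz:
    "br (\<alpha> (\<beta> x)) (br y z) = br (br (\<beta> x) y) (\<beta> z) + br (\<beta> y) (br (\<alpha> x) z)"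

locale right_bihom_leibniz_algebra = bihom_structure +
  assumes right_leibniz:
    "br (br x y) (\<alpha> (\<beta> z)) = br (br x (\<beta> z)) (\<alpha> y) + br (\<alpha> x) (br y (\<alpha> z))"

locale left_bihom_lie_algebra = left_bihom_leibniz_algebra +
  assumes skew_symmetric: "bihom_skew_symmetric br \<alpha> \<beta>"

locale right_bihom_lie_algebra = right_bihom_leibniz_algebra +
  assumes skew_symmetric: "bihom_skew_symmetric br \<alpha> \<beta>"

end

theory Submission
  imports Defs
begin

text \<open>The idea is to untwist the bracket.  As \<open>\<alpha>\<close> and \<open>\<beta>\<close> are invertible, there is a bracket
  \<open>{x, y} = [\<alpha>\<inverse> x, \<beta>\<inverse> y]\<close>, so that \<open>[x, y] = {\<alpha> x, \<beta> y}\<close>.  It is again biadditive with \<open>\<alpha>\<close> and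
  \<open>\<beta>\<close> as endomorphisms, and since \<open>[\<beta> x, \<alpha> y] = {\<alpha> \<beta> x, \<alpha> \<beta> y}\<close>, BiHom-skew-symmetry of \<open>[_, _]\<close>
  is ordinary skew-symmetry of \<open>{_, _}\<close>.  Pulling all occurrences of \<open>\<alpha>\<close> and \<open>\<beta>\<close> down to the
  variables turns each of the three BiHom identities into the corresponding ordinary identity
  for \<open>{_, _}\<close>, evaluated at images of \<open>x\<close>, \<open>y\<close>, \<open>z\<close> under compositions of \<open>\<alpha>\<close> and \<open>\<beta>\<close>; those
  compositions are onto, so the ordinary identity holds everywhere
  (\<open>bihom_jacobi_iff\<close>, \<open>bihom_left_leibniz_iff\<close>, \<open>bihom_right_leibniz_iff\<close>).  It remains to use
  the classical fact that the Jacobi identity and the two Leibniz identities agree for a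
  skew-symmetric bracket (\<open>jacobi_iff_left_leibniz\<close>, \<open>left_leibniz_iff_right_leibniz\<close>).\<close>

definition jacobi :: "('v::ab_group_add \<Rightarrow> 'v \<Rightarrow> 'v) \<Rightarrow> bool" where
  "jacobi f \<longleftrightarrow> (\<forall>x y z. f x (f y z) + f y (f z x) + f z (f x y) = 0)"

definition left_leibniz :: "('v::ab_group_add \<Rightarrow> 'v \<Rightarrow> 'v) \<Rightarrow> bool" where
  "left_leibniz f \<longleftrightarrow> (\<forall>x y z. f x (f y z) = f (f x y) z + f y (f x z))"

definition right_leibniz :: "('v::ab_group_add \<Rightarrow> 'v \<Rightarrow> 'v) \<Rightarrow> bool" where
  "right_leibniz f \<longleftrightarrow> (\<forall>x y z. f (f x y) z = f (f x z) y + f x (f y z))"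

locale skew_bracket =
  fixes f :: "'v::ab_group_add \<Rightarrow> 'v \<Rightarrow> 'v"
  assumes skew: "f x y = - f y x"
    and minus_right: "f x (- y) = - f x y"
begin

text \<open>The two terms on the right of the left Leibniz identity are the negatives of the last two
  terms of the Jacobi identity: skew-symmetry is applied once to the outer and once to the inner
  bracket.\<close>

lemma jacobi_iff_left_leibniz: "jacobi f \<longleftrightarrow> left_leibniz f"
proof -
  have "f x (f y z) + f y (f z x) + f z (f x y) = 0
      \<longleftrightarrow> f x (f y z) = f (f x y) z + f y (f x z)" for x y z
  proof -
    have rhs: "f (f x y) z + f y (f x z) = - (f y (f z x) + f z (f x y))"
      using skew[of "f x y" z] skew[of x z] by (simp add: minus_right)
    show ?thesis
      unfolding rhs add.assoc by (rule eq_neg_iff_add_eq_0[symmetric])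
  qed
  then show ?thesis
    unfolding jacobi_def left_leibniz_def by simp
qed

text \<open>The two Leibniz identities differ only in the side on which \<open>f y (f x z) = - f (f x z) y\<close>
  is placed.\<close>

lemma left_leibniz_iff_right_leibniz: "left_leibniz f \<longleftrightarrow> right_leibniz f"
proof -
  have "f x (f y z) = f (f x y) z + f y (f x z)
      \<longleftrightarrow> f (f x y) z = f (f x z) y + f x (f y z)" for x y z
    using skew[of "f x z" y] by (auto simp: algebra_simps)
  then show ?thesis
    unfolding left_leibniz_def right_leibniz_def by simp
qed

end

lemma all_surj_image3:
  assumes "surj a" and "surj b" and "surj c"
  shows "(\<forall>x y z. P (a x) (b y) (c z)) \<longleftrightarrow> (\<forall>x y z. P x y z)"
proof (intro iffI allI)
  fix x y z
  assume *: "\<forall>x y z. P (a x) (b y) (c z)"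
  obtain x' y' z' where "x = a x'" "y = b y'" "z = c z'"
    using assms by (meson surjD)
  with * show "P x y z" by blast
qed blast

locale twisted_bracket =
  fixes f br :: "'v::ab_group_add \<Rightarrow> 'v \<Rightarrow> 'v" and \<alpha> \<beta> :: "'v \<Rightarrow> 'v"
  assumes twist: "br x y = f (\<alpha> x) (\<beta> y)"
    and \<alpha>_hom: "\<alpha> (f x y) = f (\<alpha> x) (\<alpha> y)"
    and \<beta>_hom: "\<beta> (f x y) = f (\<beta> x) (\<beta> y)"
    and \<beta>_\<alpha>: "\<beta> (\<alpha> x) = \<alpha> (\<beta> x)"
    and surj_\<alpha>: "surj \<alpha>" and surj_\<beta>: "surj \<beta>"
begin

text \<open>Rewriting with these rules brings every BiHom expression into a normal form in \<open>f\<close> with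
  all maps at the variables and \<open>\<alpha>\<close> outside \<open>\<beta>\<close>.\<close>

lemmas untwist = twist \<alpha>_hom \<beta>_hom \<beta>_\<alpha>

lemma surj_compositions:
  shows "surj (\<lambda>x. \<alpha> (\<alpha> x))" and "surj (\<lambda>x. \<alpha> (\<beta> x))" and "surj (\<lambda>x. \<beta> (\<beta> x))"
    and "surj (\<lambda>x. \<alpha> (\<alpha> (\<beta> x)))" and "surj (\<lambda>x. \<alpha> (\<beta> (\<beta> x)))"
  using comp_surj[OF surj_\<alpha> surj_\<alpha>] comp_surj[OF surj_\<beta> surj_\<alpha>]
    comp_surj[OF surj_\<beta> surj_\<beta>] comp_surj[OF comp_surj[OF surj_\<beta> surj_\<alpha>] surj_\<alpha>]
    comp_surj[OF comp_surj[OF surj_\<beta> surj_\<beta>] surj_\<alpha>]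
  by (simp_all add: comp_def)

lemma bihom_skew_symmetric_iff:
  "bihom_skew_symmetric br \<alpha> \<beta> \<longleftrightarrow> (\<forall>x y. f x y = - f y x)"
proof -
  have "bihom_skew_symmetric br \<alpha> \<beta>
      \<longleftrightarrow> (\<forall>x y. f (\<alpha> (\<beta> x)) (\<alpha> (\<beta> y)) = - f (\<alpha> (\<beta> y)) (\<alpha> (\<beta> x)))"
    unfolding bihom_skew_symmetric_def by (simp add: untwist)
  also have "\<dots> \<longleftrightarrow> (\<forall>x y. f x y = - f y x)"
    using all_surj_image3[OF surj_compositions(2) surj_compositions(2) surj_compositions(2),
        where P = "\<lambda>x y z. f x y = - f y x"] by simp
  finally show ?thesis .
qed

text \<open>The Jacobi identity is cyclically symmetric, and accordingly all three variables are
  substituted by the same map \<open>\<alpha> \<beta>\<^sup>2\<close>.  The Leibniz identities distinguish their variables,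
  hence three different substitutions.\<close>

lemma bihom_jacobi_iff:
  "(\<forall>x y z. br (\<beta> (\<beta> x)) (br (\<beta> y) (\<alpha> z)) + br (\<beta> (\<beta> y)) (br (\<beta> z) (\<alpha> x))
         + br (\<beta> (\<beta> z)) (br (\<beta> x) (\<alpha> y)) = 0) \<longleftrightarrow> jacobi f"
proof -
  define J where "J x y z \<longleftrightarrow> f x (f y z) + f y (f z x) + f z (f x y) = 0" for x y z
  have "br (\<beta> (\<beta> x)) (br (\<beta> y) (\<alpha> z)) + br (\<beta> (\<beta> y)) (br (\<beta> z) (\<alpha> x))
         + br (\<beta> (\<beta> z)) (br (\<beta> x) (\<alpha> y)) = 0
      \<longleftrightarrow> J (\<alpha> (\<beta> (\<beta> x))) (\<alpha> (\<beta> (\<beta> y))) (\<alpha> (\<beta> (\<beta> z)))" for x y z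
    unfolding J_def by (simp add: untwist)
  moreover have "(\<forall>x y z. J (\<alpha> (\<beta> (\<beta> x))) (\<alpha> (\<beta> (\<beta> y))) (\<alpha> (\<beta> (\<beta> z)))) \<longleftrightarrow> (\<forall>x y z. J x y z)"
    by (rule all_surj_image3 surj_compositions)+
  ultimately show ?thesis
    unfolding jacobi_def J_def by simp
qed

lemma bihom_left_leibniz_iff:
  "(\<forall>x y z. br (\<alpha> (\<beta> x)) (br y z) = br (br (\<beta> x) y) (\<beta> z) + br (\<beta> y) (br (\<alpha> x) z))
     \<longleftrightarrow> left_leibniz f"
proof -
  define L where "L x y z \<longleftrightarrow> f x (f y z) = f (f x y) z + f y (f x z)" for x y z
  have "br (\<alpha> (\<beta> x)) (br y z) = br (br (\<beta> x) y) (\<beta> z) + br (\<beta> y) (br (\<alpha> x) z)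
      \<longleftrightarrow> L (\<alpha> (\<alpha> (\<beta> x))) (\<alpha> (\<beta> y)) (\<beta> (\<beta> z))" for x y z
    unfolding L_def by (simp add: untwist)
  moreover have "(\<forall>x y z. L (\<alpha> (\<alpha> (\<beta> x))) (\<alpha> (\<beta> y)) (\<beta> (\<beta> z))) \<longleftrightarrow> (\<forall>x y z. L x y z)"
    by (rule all_surj_image3 surj_compositions)+
  ultimately show ?thesis
    unfolding left_leibniz_def L_def by simp
qed

lemma bihom_right_leibniz_iff:
  "(\<forall>x y z. br (br x y) (\<alpha> (\<beta> z)) = br (br x (\<beta> z)) (\<alpha> y) + br (\<alpha> x) (br y (\<alpha> z)))
     \<longleftrightarrow> right_leibniz f"
proof -
  define R where "R x y z \<longleftrightarrow> f (f x y) z = f (f x z) y + f x (f y z)" for x y z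
  have "br (br x y) (\<alpha> (\<beta> z)) = br (br x (\<beta> z)) (\<alpha> y) + br (\<alpha> x) (br y (\<alpha> z))
      \<longleftrightarrow> R (\<alpha> (\<alpha> x)) (\<alpha> (\<beta> y)) (\<alpha> (\<beta> (\<beta> z)))" for x y z
    unfolding R_def by (simp add: untwist)
  moreover have "(\<forall>x y z. R (\<alpha> (\<alpha> x)) (\<alpha> (\<beta> y)) (\<alpha> (\<beta> (\<beta> z)))) \<longleftrightarrow> (\<forall>x y z. R x y z)"
    by (rule all_surj_image3 surj_compositions)+
  ultimately show ?thesis
    unfolding right_leibniz_def R_def by simp
qed

end

lemma twisted_bracket_inverse_twist:
  assumes "bij \<alpha>" and "bij \<beta>" and comm: "\<alpha> \<circ> \<beta> = \<beta> \<circ> \<alpha>"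
    and \<alpha>_br: "\<And>x y. \<alpha> (br x y) = br (\<alpha> x) (\<alpha> y)"
    and \<beta>_br: "\<And>x y. \<beta> (br x y) = br (\<beta> x) (\<beta> y)"
  shows "twisted_bracket (\<lambda>x y. br (inv \<alpha> x) (inv \<beta> y)) br \<alpha> \<beta>"
proof -
  have inv_\<alpha> [simp]: "inv \<alpha> (\<alpha> x) = x" "\<alpha> (inv \<alpha> x) = x" for x
    using \<open>bij \<alpha>\<close> by (simp_all add: bij_is_inj bij_is_surj surj_f_inv_f)
  have inv_\<beta> [simp]: "inv \<beta> (\<beta> x) = x" "\<beta> (inv \<beta> x) = x" for x
    using \<open>bij \<beta>\<close> by (simp_all add: bij_is_inj bij_is_surj surj_f_inv_f)
  have \<beta>_\<alpha>: "\<beta> (\<alpha> x) = \<alpha> (\<beta> x)" for x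
    using comm by (metis comp_apply)
  have "\<alpha> (inv \<beta> x) = inv \<beta> (\<alpha> x)" "\<beta> (inv \<alpha> x) = inv \<alpha> (\<beta> x)" for x
    using arg_cong[OF \<beta>_\<alpha>[of "inv \<beta> x"], of "inv \<beta>"]
      arg_cong[OF \<beta>_\<alpha>[of "inv \<alpha> x"], of "inv \<alpha>"] by simp_all
  with \<beta>_\<alpha> show ?thesis
    using assms by unfold_locales (simp_all add: bij_is_surj)
qed

theorem proposition4p9:
  fixes scale :: "'k::field \<Rightarrow> 'v::ab_group_add \<Rightarrow> 'v"
    and br :: "'v \<Rightarrow> 'v \<Rightarrow> 'v"
    and \<alpha> \<beta> :: "'v \<Rightarrow> 'v"
  assumes "vector_space scale"
    and "bilinear_map scale br"
    and "Vector_Spaces.linear scale scale \<alpha>"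
    and "Vector_Spaces.linear scale scale \<beta>"
    and "\<alpha> \<circ> \<beta> = \<beta> \<circ> \<alpha>"
    and "\<And>x y. \<alpha> (br x y) = br (\<alpha> x) (\<alpha> y)"
    and "\<And>x y. \<beta> (br x y) = br (\<beta> x) (\<beta> y)"
    and "bihom_skew_symmetric br \<alpha> \<beta>"
    and "bij \<alpha>"
    and "bij \<beta>"
  shows "(bihom_lie_algebra scale br \<alpha> \<beta> \<longleftrightarrow> left_bihom_lie_algebra scale br \<alpha> \<beta>)
       \<and> (left_bihom_lie_algebra scale br \<alpha> \<beta> \<longleftrightarrow> right_bihom_lie_algebra scale br \<alpha> \<beta>)"
proof -
  define f where "f x y = br (inv \<alpha> x) (inv \<beta> y)" for x y
  interpret twisted_bracket f br \<alpha> \<beta>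
    unfolding f_def using assms by (intro twisted_bracket_inverse_twist)
  interpret skew_bracket f
  proof
    show "f x y = - f y x" for x y
      using assms(8) bihom_skew_symmetric_iff by blast
    show "f x (- y) = - f x y" for x y
    proof -
      obtain y' where y: "y = \<beta> y'"
        using surj_\<beta> by (metis surjD)
      have "inv \<beta> (- y) = - y'"
        using assms(4) \<open>bij \<beta>\<close> unfolding y
        by (metis bij_is_inj inv_f_f module_hom.neg module_hom_iff_linear)
      moreover have "br u (- v) = - br u v" for u v
        using assms(2) unfolding bilinear_map_def
        by (metis module_hom.neg module_hom_iff_linear)
      ultimately show ?thesis
        unfolding f_def y using \<open>bij \<beta>\<close> by (simp add: bij_is_inj)
    qed
  qed
  have bihom: "bihom_structure scale br \<alpha> \<beta>"
    using assms by (simp add: bihom_structure_def bihom_structure_axioms_def)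
  have "bihom_lie_algebra scale br \<alpha> \<beta> \<longleftrightarrow> jacobi f"
    using bihom assms(8)
    by (simp add: bihom_lie_algebra_def bihom_lie_algebra_axioms_def bihom_jacobi_iff)
  moreover have "left_bihom_lie_algebra scale br \<alpha> \<beta> \<longleftrightarrow> left_leibniz f"
    using bihom assms(8)
    by (simp add: left_bihom_lie_algebra_def left_bihom_lie_algebra_axioms_def
        left_bihom_leibniz_algebra_def left_bihom_leibniz_algebra_axioms_def
        bihom_left_leibniz_iff)
  moreover have "right_bihom_lie_algebra scale br \<alpha> \<beta> \<longleftrightarrow> right_leibniz f"
    using bihom assms(8)
    by (simp add: right_bihom_lie_algebra_def right_bihom_lie_algebra_axioms_def
        right_bihom_leibniz_algebra_def right_bihom_leibniz_algebra_axioms_def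
        bihom_right_leibniz_iff)
  ultimately show ?thesis
    using jacobi_iff_left_leibniz left_leibniz_iff_right_leibniz by simp
qed

end
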